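(* Let $(X,P_X)$ and $(B,P_B)$ be right-preordered groups with positive cones $P_X$ and $P_B$, and let $\varphi\colon B\to\mathrm{Aut}(X)$, $b\mapsto\varphi_b$, be an action of the group $B$ on the group $X$ by group automorphisms. Put $$P_{\mathrm{prod}}=P_X\times P_B=\{(x,b)\in X\rtimes_\varphi B\mid x\geq 0\text{ and }b\geq 0\},$$ $$P_{\mathrm{lex}}=\{(x,b)\in X\rtimes_\varphi B \mid b>0 \text{ or } (b\sim 0 \text{ and } x\geq 0)\}.$$ If $P$ is the positive cone of a compatible right-preorder on $X\rtimes_\varphi B$, then $P_{\mathrm{prod}}\subseteq P\subseteq P_{\mathrm{lex}}$.
   Context: Groups are written additively but need not be abelian. A right-preordered group is a group $X$ with a preorder (reflexive and transitive relation) $\leq$ such that $x\leq y$ implies $x+z\leq y+z$ for all $x,y,z\in X$. Its positive cone is the submonoid $P_X=\{x\in X\mid x\geq 0\}$; right-preorders on a group correspond bijectively to submonoids via $x\leq y\Leftrightarrow y-x\in P_X$, and a right-preorder is identified with its positive cone. $\mathbf{ROrdGrp}$ is the category of right-preordered groups and monotone group homomorphisms. We write $b\sim 0$ for ($b\leq 0$ and $0\leq b$), and $b>0$ for ($b\geq 0$ and not $b\sim 0$). The semidirect product $X\rtimes_\varphi B$ is the set $X\times B$ with operation $(x,b)+(y,b')=(x+\varphi_b(y),b+b')$. Let $\langle 1,0\rangle\colon X\to X\rtimes_\varphi B$, $x\mapsto(x,0)$; $\pi_B\colon X\rtimes_\varphi B\to B$, $(x,b)\mapsto b$; $\langle 0,1\rangle\colon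 B\to X\rtimes_\varphi B$, $b\mapsto (0,b)$. A right-preorder on the group $X\rtimes_\varphi B$ (equivalently, a submonoid $P$) is called compatible if these maps form a split extension in $\mathbf{ROrdGrp}$, i.e. $\pi_B$ and $\langle 0,1\rangle$ are monotone and $\langle 1,0\rangle$ is the kernel of $\pi_B$ in $\mathbf{ROrdGrp}$ (the latter meaning that $(x,0)\in P$ if and only if $x\in P_X$). *)

theory Defs
  imports "HOL-Algebra.Coset" "HOL-Algebra.Bij"
begin

text \<open>
  Groups are HOL-Algebra groups, hence written multiplicatively: the neutral element
  \<open>\<one>\<close> plays the role of \<open>0\<close>, and no commutativity is assumed. A preorder is a set of
  pairs, \<open>(x, y) \<in> r\<close> meaning \<open>x \<le> y\<close>; \<^const>\<open>preorder_on\<close> makes it a subset of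
  \<open>carrier G \<times> carrier G\<close>, so that it is determined by its positive cone.
\<close>

locale right_preordered_group = group G for G (structure) +
  fixes r :: "'a rel"
  assumes preorder: "preorder_on (carrier G) r"
    and right_mono: "\<lbrakk>(x, y) \<in> r; z \<in> carrier G\<rbrakk> \<Longrightarrow> (x \<otimes> z, y \<otimes> z) \<in> r"

definition positive_cone :: "('a, 'm) monoid_scheme \<Rightarrow> 'a rel \<Rightarrow> 'a set" where
  "positive_cone G r = {x \<in> carrier G. (\<one>\<^bsub>G\<^esub>, x) \<in> r}"

definition equiv_one :: "('a, 'm) monoid_scheme \<Rightarrow> 'a rel \<Rightarrow> 'a \<Rightarrow> bool" where
  "equiv_one G r b \<longleftrightarrow> (b, \<one>\<^bsub>G\<^esub>) \<in> r \<and> (\<one>\<^bsub>G\<^esub>, b) \<in> r"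

definition strictly_positive :: "('a, 'm) monoid_scheme \<Rightarrow> 'a rel \<Rightarrow> 'a \<Rightarrow> bool" where
  "strictly_positive G r b \<longleftrightarrow> (\<one>\<^bsub>G\<^esub>, b) \<in> r \<and> \<not> equiv_one G r b"

text \<open>The morphisms of the category of right-preordered groups.\<close>

definition monotone_hom ::
  "('a, 'm) monoid_scheme \<Rightarrow> 'a rel \<Rightarrow> ('b, 'n) monoid_scheme \<Rightarrow> 'b rel \<Rightarrow> ('a \<Rightarrow> 'b) \<Rightarrow> bool"
where
  "monotone_hom G r H s f \<longleftrightarrow>
     f \<in> hom G H \<and> monotone_on (carrier G) (\<lambda>x y. (x, y) \<in> r) (\<lambda>x y. (x, y) \<in> s) f"

text \<open>
  A kernel of \<open>p : (G, r) \<rightarrow> (H, s)\<close> in that category is a group-theoretic kernel carrying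
  the preorder induced from \<open>G\<close>, the latter being expressed by positive cones.
  Lemma \<open>is_kernel_universal\<close> below is the universal property.
\<close>

definition is_kernel ::
  "('k, 'l) monoid_scheme \<Rightarrow> 'k rel \<Rightarrow> ('a, 'm) monoid_scheme \<Rightarrow> 'a rel \<Rightarrow>
   ('b, 'n) monoid_scheme \<Rightarrow> ('k \<Rightarrow> 'a) \<Rightarrow> ('a \<Rightarrow> 'b) \<Rightarrow> bool"
where
  "is_kernel K q G r H k p \<longleftrightarrow>
     monotone_hom K q G r k \<and> inj_on k (carrier K) \<and> k ` carrier K = kernel G H p \<and>
     (\<forall>x \<in> carrier K. k x \<in> positive_cone G r \<longleftrightarrow> x \<in> positive_cone K q)"

definition split_extension ::
  "('k, 'l) monoid_scheme \<Rightarrow> 'k rel \<Rightarrow> ('a, 'm) monoid_scheme \<Rightarrow> 'a rel \<Rightarrow>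
   ('b, 'n) monoid_scheme \<Rightarrow> 'b rel \<Rightarrow> ('k \<Rightarrow> 'a) \<Rightarrow> ('a \<Rightarrow> 'b) \<Rightarrow> ('b \<Rightarrow> 'a) \<Rightarrow> bool"
where
  "split_extension K q G r H s k p i \<longleftrightarrow>
     monotone_hom G r H s p \<and> monotone_hom H s G r i \<and>
     (\<forall>b \<in> carrier H. p (i b) = b) \<and> is_kernel K q G r H k p"

definition semidirect_product ::
  "('a, 'm) monoid_scheme \<Rightarrow> ('b, 'n) monoid_scheme \<Rightarrow> ('b \<Rightarrow> 'a \<Rightarrow> 'a) \<Rightarrow> ('a \<times> 'b) monoid"
where
  "semidirect_product X B \<phi> =
     \<lparr>carrier = carrier X \<times> carrier B,
      mult = (\<lambda>(x, b) (y, b'). (x \<otimes>\<^bsub>X\<^esub> \<phi> b y, b \<otimes>\<^bsub>B\<^esub> b')),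
      one = (\<one>\<^bsub>X\<^esub>, \<one>\<^bsub>B\<^esub>)\<rparr>"

definition compatible_right_preorder ::
  "('a, 'm) monoid_scheme \<Rightarrow> 'a rel \<Rightarrow> ('b, 'n) monoid_scheme \<Rightarrow> 'b rel \<Rightarrow>
   ('b \<Rightarrow> 'a \<Rightarrow> 'a) \<Rightarrow> ('a \<times> 'b) rel \<Rightarrow> bool"
where
  "compatible_right_preorder X rX B rB \<phi> r \<longleftrightarrow>
     right_preordered_group (semidirect_product X B \<phi>) r \<and>
     split_extension X rX (semidirect_product X B \<phi>) r B rB
       (\<lambda>x. (x, \<one>\<^bsub>B\<^esub>)) (\<lambda>(x, b). b) (\<lambda>b. (\<one>\<^bsub>X\<^esub>, b))"

definition P_prod ::
  "('a, 'm) monoid_scheme \<Rightarrow> 'a rel \<Rightarrow> ('b, 'n) monoid_scheme \<Rightarrow> 'b rel \<Rightarrow> ('a \<times> 'b) set"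
where
  "P_prod X rX B rB = positive_cone X rX \<times> positive_cone B rB"

definition P_lex ::
  "('a, 'm) monoid_scheme \<Rightarrow> 'a rel \<Rightarrow> ('b, 'n) monoid_scheme \<Rightarrow> 'b rel \<Rightarrow> ('a \<times> 'b) set"
where
  "P_lex X rX B rB =
     {(x, b). x \<in> carrier X \<and> b \<in> carrier B \<and>
        (strictly_positive B rB b \<or> (equiv_one B rB b \<and> x \<in> positive_cone X rX))}"

lemma (in right_preordered_group) le_iff_positive_cone:
  assumes "x \<in> carrier G" "y \<in> carrier G"
  shows "(x, y) \<in> r \<longleftrightarrow> y \<otimes> inv x \<in> positive_cone G r"
proof
  assume "(x, y) \<in> r"
  then have "(x \<otimes> inv x, y \<otimes> inv x) \<in> r" using assms by (intro right_mono) auto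
  then show "y \<otimes> inv x \<in> positive_cone G r" using assms by (simp add: positive_cone_def)
next
  assume "y \<otimes> inv x \<in> positive_cone G r"
  then have "(\<one>, y \<otimes> inv x) \<in> r" by (simp add: positive_cone_def)
  from right_mono[OF this assms(1)] show "(x, y) \<in> r" using assms by (simp add: m_assoc)
qed

lemma is_kernel_universal:
  assumes K: "right_preordered_group K q" and G: "right_preordered_group G r"
    and L: "right_preordered_group L t" and H: "group H"
    and p: "p \<in> hom G H" and k: "is_kernel K q G r H k p"
    and g: "monotone_hom L t G r g" and pg: "\<And>z. z \<in> carrier L \<Longrightarrow> p (g z) = \<one>\<^bsub>H\<^esub>"
  shows "\<exists>h. monotone_hom L t K q h \<and> (\<forall>z \<in> carrier L. k (h z) = g z) \<and>
    (\<forall>h'. monotone_hom L t K q h' \<and> (\<forall>z \<in> carrier L. k (h' z) = g z) \<longrightarrow>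
       (\<forall>z \<in> carrier L. h' z = h z))"
proof -
  interpret K: right_preordered_group K q by fact
  interpret G: right_preordered_group G r by fact
  interpret L: right_preordered_group L t by fact
  have kh: "k \<in> hom K G" and inj: "inj_on k (carrier K)"
    and im: "k ` carrier K = kernel G H p"
    and cone: "\<And>x. x \<in> carrier K \<Longrightarrow> k x \<in> positive_cone G r \<longleftrightarrow> x \<in> positive_cone K q"
    using k by (auto simp: is_kernel_def monotone_hom_def)
  have gh: "g \<in> hom L G" using g by (simp add: monotone_hom_def)
  interpret k: group_hom K G k by unfold_locales (rule kh)
  interpret g: group_hom L G g by unfold_locales (rule gh)
  define h where "h = (\<lambda>z. inv_into (carrier K) k (g z))"
  have gk: "g z \<in> k ` carrier K" if "z \<in> carrier L" for z
    using that pg by (simp add: im kernel_def)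
  have hK: "h z \<in> carrier K" and kh_eq: "k (h z) = g z" if "z \<in> carrier L" for z
    using gk[OF that] by (auto simp: h_def inv_into_into f_inv_into_f)
  have hom: "h \<in> hom L K"
  proof (rule homI)
    fix y z assume yz: "y \<in> carrier L" "z \<in> carrier L"
    show "h (y \<otimes>\<^bsub>L\<^esub> z) = h y \<otimes>\<^bsub>K\<^esub> h z"
      by (rule inj_onD[OF inj]) (use yz in \<open>simp_all add: hK kh_eq\<close>)
  qed (rule hK)
  have mono: "(h y, h z) \<in> q" if yz: "y \<in> carrier L" "z \<in> carrier L" and le: "(y, z) \<in> t" for y z
  proof -
    have "(g y, g z) \<in> r" using g yz le by (auto simp: monotone_hom_def monotone_on_def)
    then have "g z \<otimes>\<^bsub>G\<^esub> inv\<^bsub>G\<^esub> g y \<in> positive_cone G r"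
      using G.le_iff_positive_cone yz by simp
    then have "k (h z \<otimes>\<^bsub>K\<^esub> inv\<^bsub>K\<^esub> h y) \<in> positive_cone G r"
      using yz by (simp add: hK kh_eq)
    then have "h z \<otimes>\<^bsub>K\<^esub> inv\<^bsub>K\<^esub> h y \<in> positive_cone K q"
      using yz hK by (intro iffD1[OF cone]) auto
    then show ?thesis using yz by (simp add: hK K.le_iff_positive_cone)
  qed
  have uniq: "h' z = h z"
    if "monotone_hom L t K q h'" "\<forall>z \<in> carrier L. k (h' z) = g z" "z \<in> carrier L" for h' z
    using that hK kh_eq by (intro inj_onD[OF inj]) (auto simp: monotone_hom_def hom_def)
  show ?thesis
    using hom mono kh_eq uniq by (intro exI[of _ h]) (auto simp: monotone_hom_def monotone_on_def)
qed

lemma action_simps: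
  assumes X: "group X" and B: "group B" and \<phi>: "\<phi> \<in> hom B (AutoGroup X)"
  shows action_closed: "\<And>b x. \<lbrakk>b \<in> carrier B; x \<in> carrier X\<rbrakk> \<Longrightarrow> \<phi> b x \<in> carrier X"
    and action_mult: "\<And>b x y. \<lbrakk>b \<in> carrier B; x \<in> carrier X; y \<in> carrier X\<rbrakk>
      \<Longrightarrow> \<phi> b (x \<otimes>\<^bsub>X\<^esub> y) = \<phi> b x \<otimes>\<^bsub>X\<^esub> \<phi> b y"
    and action_action: "\<And>b c x. \<lbrakk>b \<in> carrier B; c \<in> carrier B; x \<in> carrier X\<rbrakk>
      \<Longrightarrow> \<phi> (b \<otimes>\<^bsub>B\<^esub> c) x = \<phi> b (\<phi> c x)"
    and action_one: "\<And>x. x \<in> carrier X \<Longrightarrow> \<phi> \<one>\<^bsub>B\<^esub> x = x"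
    and action_on_one: "\<And>b. b \<in> carrier B \<Longrightarrow> \<phi> b \<one>\<^bsub>X\<^esub> = \<one>\<^bsub>X\<^esub>"
proof -
  interpret X: group X by fact
  interpret B: group B by fact
  interpret A: group "AutoGroup X" by (rule X.AutoGroup)
  interpret \<phi>: group_hom B "AutoGroup X" \<phi> by unfold_locales (rule \<phi>)
  have car: "\<phi> b \<in> hom X X" "\<phi> b \<in> Bij (carrier X)" if "b \<in> carrier B" for b
    using \<phi>.hom_closed[OF that] by (auto simp: AutoGroup_def auto_def)
  have cl: "\<phi> b x \<in> carrier X" if "b \<in> carrier B" "x \<in> carrier X" for b x
    using car(1)[OF that(1)] that(2) by (auto simp: hom_def)
  have add: "\<phi> b (x \<otimes>\<^bsub>X\<^esub> y) = \<phi> b x \<otimes>\<^bsub>X\<^esub> \<phi> b y"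
    if "b \<in> carrier B" "x \<in> carrier X" "y \<in> carrier X" for b x y
    using car(1)[OF that(1)] that(2,3) by (auto simp: hom_def)
  have comp: "\<phi> (b \<otimes>\<^bsub>B\<^esub> c) x = \<phi> b (\<phi> c x)"
    if "b \<in> carrier B" "c \<in> carrier B" "x \<in> carrier X" for b c x
    using \<phi>.hom_mult[OF that(1,2)] car[OF that(1)] car[OF that(2)] that(3)
    by (simp add: AutoGroup_def BijGroup_def compose_def)
  have one: "\<phi> \<one>\<^bsub>B\<^esub> x = x" if "x \<in> carrier X" for x
    using \<phi>.hom_one that by (simp add: AutoGroup_def BijGroup_def)
  have onone: "\<phi> b \<one>\<^bsub>X\<^esub> = \<one>\<^bsub>X\<^esub>" if "b \<in> carrier B" for b
    using hom_one[OF car(1)[OF that] X X] .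
  show "\<And>b x. \<lbrakk>b \<in> carrier B; x \<in> carrier X\<rbrakk> \<Longrightarrow> \<phi> b x \<in> carrier X" by (fact cl)
  show "\<And>b x y. \<lbrakk>b \<in> carrier B; x \<in> carrier X; y \<in> carrier X\<rbrakk>
      \<Longrightarrow> \<phi> b (x \<otimes>\<^bsub>X\<^esub> y) = \<phi> b x \<otimes>\<^bsub>X\<^esub> \<phi> b y" by (fact add)
  show "\<And>b c x. \<lbrakk>b \<in> carrier B; c \<in> carrier B; x \<in> carrier X\<rbrakk>
      \<Longrightarrow> \<phi> (b \<otimes>\<^bsub>B\<^esub> c) x = \<phi> b (\<phi> c x)" by (fact comp)
  show "\<And>x. x \<in> carrier X \<Longrightarrow> \<phi> \<one>\<^bsub>B\<^esub> x = x" by (fact one)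
  show "\<And>b. b \<in> carrier B \<Longrightarrow> \<phi> b \<one>\<^bsub>X\<^esub> = \<one>\<^bsub>X\<^esub>" by (fact onone)
qed

lemma group_semidirect_product:
  assumes X: "group X" and B: "group B" and \<phi>: "\<phi> \<in> hom B (AutoGroup X)"
  shows "group (semidirect_product X B \<phi>)"
proof -
  interpret X: group X by fact
  interpret B: group B by fact
  note act = action_simps[OF assms]
  show ?thesis
  proof (rule groupI)
    fix u assume "u \<in> carrier (semidirect_product X B \<phi>)"
    then obtain x b where u: "u = (x, b)" "x \<in> carrier X" "b \<in> carrier B"
      by (auto simp: semidirect_product_def)
    have "\<phi> (inv\<^bsub>B\<^esub> b) (inv\<^bsub>X\<^esub> x) \<otimes>\<^bsub>X\<^esub> \<phi> (inv\<^bsub>B\<^esub> b) x = \<one>\<^bsub>X\<^esub>"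
      using u act(2)[of "inv\<^bsub>B\<^esub> b" "inv\<^bsub>X\<^esub> x" x] act(5)[of "inv\<^bsub>B\<^esub> b"]
      by simp
    then show "\<exists>y\<in>carrier (semidirect_product X B \<phi>). y \<otimes>\<^bsub>semidirect_product X B \<phi>\<^esub> u
      = \<one>\<^bsub>semidirect_product X B \<phi>\<^esub>"
      using u act(1) by (intro bexI[of _ "(\<phi> (inv\<^bsub>B\<^esub> b) (inv\<^bsub>X\<^esub> x), inv\<^bsub>B\<^esub> b)"])
        (auto simp: semidirect_product_def)
  qed (auto simp: semidirect_product_def act X.m_assoc B.m_assoc)
qed

text \<open>Compatibility amounts to two monotonicity conditions and one condition on positive cones.\<close>

lemma compatible_right_preorder_iff:
  assumes X: "right_preordered_group X rX" and B: "right_preordered_group B rB"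
    and \<phi>: "\<phi> \<in> hom B (AutoGroup X)"
  shows "compatible_right_preorder X rX B rB \<phi> r \<longleftrightarrow>
    right_preordered_group (semidirect_product X B \<phi>) r \<and>
    (\<forall>x b y c. ((x, b), (y, c)) \<in> r \<longrightarrow> (b, c) \<in> rB) \<and>
    (\<forall>b c. (b, c) \<in> rB \<longrightarrow> ((\<one>\<^bsub>X\<^esub>, b), (\<one>\<^bsub>X\<^esub>, c)) \<in> r) \<and>
    (\<forall>x \<in> carrier X. (x, \<one>\<^bsub>B\<^esub>) \<in> positive_cone (semidirect_product X B \<phi>) r \<longleftrightarrow>
       x \<in> positive_cone X rX)"
    (is "_ \<longleftrightarrow> ?R \<and> ?M1 \<and> ?M2 \<and> ?C")
proof (cases ?R)
  case R: True
  let ?S = "semidirect_product X B \<phi>"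
  interpret X: right_preordered_group X rX by fact
  interpret B: right_preordered_group B rB by fact
  interpret S: right_preordered_group ?S r by fact
  note act = action_simps[OF X.is_group B.is_group \<phi>]
  have carS: "carrier ?S = carrier X \<times> carrier B"
    and mulS: "(x, b) \<otimes>\<^bsub>?S\<^esub> (y, c) = (x \<otimes>\<^bsub>X\<^esub> \<phi> b y, b \<otimes>\<^bsub>B\<^esub> c)" for x b y c
    by (simp_all add: semidirect_product_def)
  have sub: "r \<subseteq> (carrier X \<times> carrier B) \<times> (carrier X \<times> carrier B)"
    "rB \<subseteq> carrier B \<times> carrier B" "rX \<subseteq> carrier X \<times> carrier X"
    using S.preorder B.preorder X.preorder by (auto simp: preorder_on_def carS)
  have hp: "(\<lambda>(x, b). b) \<in> hom ?S B" and hi: "(\<lambda>b. (\<one>\<^bsub>X\<^esub>, b)) \<in> hom B ?S"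
    and hk: "(\<lambda>x. (x, \<one>\<^bsub>B\<^esub>)) \<in> hom X ?S"
    by (auto simp: hom_def carS mulS act)
  have p: "monotone_hom ?S r B rB (\<lambda>(x, b). b) \<longleftrightarrow> ?M1"
    using sub hp unfolding monotone_hom_def monotone_on_def carS by fastforce
  have i: "monotone_hom B rB ?S r (\<lambda>b. (\<one>\<^bsub>X\<^esub>, b)) \<longleftrightarrow> ?M2"
    using sub hi unfolding monotone_hom_def monotone_on_def by blast
  have k: "monotone_hom X rX ?S r (\<lambda>x. (x, \<one>\<^bsub>B\<^esub>))" if C: ?C
  proof -
    interpret k: group_hom X ?S "\<lambda>x. (x, \<one>\<^bsub>B\<^esub>)" by unfold_locales (rule hk)
    have "((x, \<one>\<^bsub>B\<^esub>), (y, \<one>\<^bsub>B\<^esub>)) \<in> r" if "x \<in> carrier X" "y \<in> carrier X" "(x, y) \<in> rX" for x y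
    proof -
      have "y \<otimes>\<^bsub>X\<^esub> inv\<^bsub>X\<^esub> x \<in> positive_cone X rX" using X.le_iff_positive_cone that by blast
      then have "(y \<otimes>\<^bsub>X\<^esub> inv\<^bsub>X\<^esub> x, \<one>\<^bsub>B\<^esub>) \<in> positive_cone ?S r" using C that(1,2) X.m_closed X.inv_closed by blast
      then have "(y, \<one>\<^bsub>B\<^esub>) \<otimes>\<^bsub>?S\<^esub> inv\<^bsub>?S\<^esub> (x, \<one>\<^bsub>B\<^esub>) \<in> positive_cone ?S r"
        by (metis k.hom_mult k.hom_inv X.inv_closed that(1,2))
      then show ?thesis using that S.le_iff_positive_cone by (simp add: carS)
    qed
    then show ?thesis using hk by (auto simp: monotone_hom_def monotone_on_def)
  qed
  have "(\<lambda>x. (x, \<one>\<^bsub>B\<^esub>)) ` carrier X = kernel ?S B (\<lambda>(x, b). b)"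
    by (auto simp: kernel_def carS)
  then have ker: "is_kernel X rX ?S r B (\<lambda>x. (x, \<one>\<^bsub>B\<^esub>)) (\<lambda>(x, b). b) \<longleftrightarrow> ?C"
    using k by (auto simp: is_kernel_def inj_on_def)
  show ?thesis
    unfolding compatible_right_preorder_def split_extension_def p i ker using R by simp
qed (simp add: compatible_right_preorder_def)

end

theory Submission
  imports Defs
begin

text \<open>In additive notation, (x,b) = (x,0) + (0,b). If x \<ge> 0 and b \<ge> 0, the kernel
  condition puts (x,0) in P and monotonicity of the section puts (0,b) in P, so their sum lies in
  the submonoid P. Conversely, let (x,b) be in P. Projecting gives b \<ge> 0. If b > 0, nothing is
  asked of x. If b \<sim> 0, then -b \<ge> 0 as well, so (0,-b) is in P and (x,b) + (0,-b) = (x,0)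
  is in P, whence x \<ge> 0 by the kernel condition. \<open>compatible_right_preorder_iff\<close>
  turns compatibility into exactly the three facts used here. Closure of P under addition appears as
  a right translation followed by transitivity.\<close>

theorem proposition4p1:
  fixes X :: "('a, 'm) monoid_scheme" and rX :: "'a rel"
    and B :: "('b, 'n) monoid_scheme" and rB :: "'b rel"
    and \<phi> :: "'b \<Rightarrow> 'a \<Rightarrow> 'a"
    and r :: "('a \<times> 'b) rel" and P :: "('a \<times> 'b) set"
  assumes "right_preordered_group X rX"
    and "right_preordered_group B rB"
    and "\<phi> \<in> hom B (AutoGroup X)"
    and "compatible_right_preorder X rX B rB \<phi> r"
    and "P = positive_cone (semidirect_product X B \<phi>) r"
  shows "P_prod X rX B rB \<subseteq> P \<and> P \<subseteq> P_lex X rX B rB"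
proof -
  let ?S = "semidirect_product X B \<phi>"
  interpret X: right_preordered_group X rX by fact
  interpret B: right_preordered_group B rB by fact
  have R: "right_preordered_group ?S r"
    and proj: "\<And>x b y c. ((x, b), (y, c)) \<in> r \<Longrightarrow> (b, c) \<in> rB"
    and incl: "\<And>b c. (b, c) \<in> rB \<Longrightarrow> ((\<one>\<^bsub>X\<^esub>, b), (\<one>\<^bsub>X\<^esub>, c)) \<in> r"
    and cone: "\<And>x. x \<in> carrier X \<Longrightarrow>
      (x, \<one>\<^bsub>B\<^esub>) \<in> positive_cone ?S r \<longleftrightarrow> x \<in> positive_cone X rX"
    using assms(4) unfolding compatible_right_preorder_iff[OF assms(1-3)] by blast+
  interpret S: right_preordered_group ?S r by (fact R)
  note act = action_simps[OF X.is_group B.is_group assms(3)]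
  have carS: "carrier ?S = carrier X \<times> carrier B"
    and oneS: "\<one>\<^bsub>?S\<^esub> = (\<one>\<^bsub>X\<^esub>, \<one>\<^bsub>B\<^esub>)"
    and mulS: "\<And>x b y c. (x, b) \<otimes>\<^bsub>?S\<^esub> (y, c) = (x \<otimes>\<^bsub>X\<^esub> \<phi> b y, b \<otimes>\<^bsub>B\<^esub> c)"
    by (simp_all add: semidirect_product_def)
  have trans: "(u, w) \<in> r" if "(u, v) \<in> r" "(v, w) \<in> r" for u v w
    using S.preorder that by (auto simp: preorder_on_def dest: transD)
  have prod: "(x, b) \<in> positive_cone ?S r"
    if "x \<in> positive_cone X rX" "b \<in> positive_cone B rB" for x b
  proof -
    have x: "x \<in> carrier X" and b: "b \<in> carrier B" "(\<one>\<^bsub>B\<^esub>, b) \<in> rB"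
      using that by (auto simp: positive_cone_def)
    have "(\<one>\<^bsub>?S\<^esub>, (x, \<one>\<^bsub>B\<^esub>)) \<in> r"
      using cone[OF x] that(1) by (simp add: positive_cone_def)
    \<comment> \<open>The right factor has neutral first component, which every automorphism fixes,
      so the action disappears from both products.\<close>
    then have "(\<one>\<^bsub>?S\<^esub> \<otimes>\<^bsub>?S\<^esub> (\<one>\<^bsub>X\<^esub>, b), (x, \<one>\<^bsub>B\<^esub>) \<otimes>\<^bsub>?S\<^esub> (\<one>\<^bsub>X\<^esub>, b)) \<in> r"
      using b by (intro S.right_mono) (simp_all add: carS)
    then have "((\<one>\<^bsub>X\<^esub>, b), (x, b)) \<in> r"
      using x b by (simp add: oneS mulS act)
    \<comment> \<open>The section sends 1 \<le> b to (1,1) \<le> (1,b), which chains with (1,b)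
      \<le> (x,b).\<close>
    from trans[OF incl[OF b(2)] this] show ?thesis
      using x b by (simp add: positive_cone_def carS oneS)
  qed
  have lex: "(x, b) \<in> P_lex X rX B rB" if pos: "(x, b) \<in> positive_cone ?S r" for x b
  proof -
    have x: "x \<in> carrier X" and b: "b \<in> carrier B" and le: "(\<one>\<^bsub>?S\<^esub>, (x, b)) \<in> r"
      using pos by (auto simp: positive_cone_def carS)
    have b_pos: "(\<one>\<^bsub>B\<^esub>, b) \<in> rB" using le proj by (simp add: oneS)
    have "x \<in> positive_cone X rX" if "equiv_one B rB b"
    proof -
      \<comment> \<open>Translating b \<le> 1 by the inverse of b shows that this inverse is
        positive: this is where the half b \<le> 1 of the equivalence enters.\<close>
      have "(b \<otimes>\<^bsub>B\<^esub> inv\<^bsub>B\<^esub> b, \<one>\<^bsub>B\<^esub> \<otimes>\<^bsub>B\<^esub> inv\<^bsub>B\<^esub> b) \<in> rB"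
        using that b by (intro B.right_mono) (simp_all add: equiv_one_def)
      then have inv_pos: "(\<one>\<^bsub>B\<^esub>, inv\<^bsub>B\<^esub> b) \<in> rB" using b by simp
      \<comment> \<open>This translation cancels b and leaves x unchanged, moving (x,b) into the
        image of the kernel, where \<open>cone\<close> applies.\<close>
      have "(\<one>\<^bsub>?S\<^esub> \<otimes>\<^bsub>?S\<^esub> (\<one>\<^bsub>X\<^esub>, inv\<^bsub>B\<^esub> b), (x, b) \<otimes>\<^bsub>?S\<^esub> (\<one>\<^bsub>X\<^esub>, inv\<^bsub>B\<^esub> b)) \<in> r"
        using le b by (intro S.right_mono) (simp_all add: carS)
      then have "((\<one>\<^bsub>X\<^esub>, inv\<^bsub>B\<^esub> b), (x, \<one>\<^bsub>B\<^esub>)) \<in> r"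
        using x b by (simp add: oneS mulS act)
      from trans[OF incl[OF inv_pos] this] show ?thesis
        using x by (intro iffD1[OF cone]) (simp_all add: positive_cone_def carS oneS)
    qed
    then show ?thesis
      using x b b_pos by (auto simp: P_lex_def strictly_positive_def)
  qed
  show ?thesis
    using prod lex by (auto simp: P_prod_def assms(5))
qed

end
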